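(* (1) Let $X$ be a completely regular space. If $X$ is locally connected then $X$ is an rr-good space. (2) A connected space need not be rr-good even when it is a compact metric space; that is, there exists a connected compact metric space $X$ which is not rr-good.
   Context: $C(X)$ is the ring of continuous real-valued functions on $X$. The reduced ring order (rr-order) on a reduced ring, in particular on $C(X)$, is the partial order $a\le_{\mathrm{rr}} b$ if and only if $ab=a^2$. A completely regular space $X$ is called rr-good if $C(X)$ is a lower semi-lattice in the rr-order, i.e. every pair $f,g\in C(X)$ has an infimum $f\wedge_{\mathrm{rr}} g$. A space $X$ is locally connected if for each $x\in X$ and each neighbourhood $N$ of $x$ there is a connected subset $C\subseteq N$ such that $x$ is in the interior of $C$. Completely regular spaces are taken to be Hausdorff, as in Gillman–Jerison. *)

theory Defs
  imports "HOL-Analysis.Analysis" "HOL-Algebra.Ring" "HOL-Algebra.Lattice"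
begin

text \<open>
  The ring \<open>C(X)\<close>.  Functions are taken to be \<^const>\<open>extensional\<close> on the underlying set of
  \<open>X\<close>, so that elements of the carrier correspond exactly to continuous real-valued functions
  on \<open>X\<close> and equality in the ring is pointwise equality on \<open>X\<close>.
\<close>

definition cont_ring :: "'a topology \<Rightarrow> ('a \<Rightarrow> real) ring" where
  "cont_ring X =
    \<lparr> carrier = {f \<in> extensional (topspace X). continuous_map X euclideanreal f},
      monoid.mult = (\<lambda>f g. \<lambda>x\<in>topspace X. f x * g x),
      one = (\<lambda>x\<in>topspace X. 1),
      zero = (\<lambda>x\<in>topspace X. 0),
      add = (\<lambda>f g. \<lambda>x\<in>topspace X. f x + g x) \<rparr>"

definition reduced_ring :: "('a, 'm) ring_scheme \<Rightarrow> bool" where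
  "reduced_ring R \<longleftrightarrow>
    cring R \<and> (\<forall>a\<in>carrier R. \<forall>n::nat. a [^]\<^bsub>R\<^esub> n = \<zero>\<^bsub>R\<^esub> \<longrightarrow> a = \<zero>\<^bsub>R\<^esub>)"

definition rr_order :: "('a, 'm) ring_scheme \<Rightarrow> 'a gorder" where
  "rr_order R =
    \<lparr> carrier = carrier R,
      eq = (=),
      le = (\<lambda>a b. a \<otimes>\<^bsub>R\<^esub> b = a [^]\<^bsub>R\<^esub> (2::nat)) \<rparr>"

definition rr_good :: "'a topology \<Rightarrow> bool" where
  "rr_good X \<longleftrightarrow> lower_semilattice (rr_order (cont_ring X))"

lemma carrier_cont_ring [simp]:
  "f \<in> carrier (cont_ring X) \<longleftrightarrow>
     f \<in> extensional (topspace X) \<and> continuous_map X euclideanreal f"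
  by (simp add: cont_ring_def)

lemma mult_cont_ring [simp]: "f \<otimes>\<^bsub>cont_ring X\<^esub> g = (\<lambda>x\<in>topspace X. f x * g x)"
  and add_cont_ring [simp]: "f \<oplus>\<^bsub>cont_ring X\<^esub> g = (\<lambda>x\<in>topspace X. f x + g x)"
  and one_cont_ring [simp]: "\<one>\<^bsub>cont_ring X\<^esub> = (\<lambda>x\<in>topspace X. 1)"
  and zero_cont_ring [simp]: "\<zero>\<^bsub>cont_ring X\<^esub> = (\<lambda>x\<in>topspace X. 0)"
  by (simp_all add: cont_ring_def)

lemma continuous_map_restrict_real:
  "continuous_map X euclideanreal (restrict f (topspace X)) \<longleftrightarrow> continuous_map X euclideanreal f"
  by (rule iffI; erule continuous_map_eq; simp)

lemma cring_cont_ring: "cring (cont_ring X)"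
proof (rule cringI)
  show "abelian_group (cont_ring X)"
  proof (rule abelian_groupI)
    fix f assume f: "f \<in> carrier (cont_ring X)"
    show "\<exists>g\<in>carrier (cont_ring X). g \<oplus>\<^bsub>cont_ring X\<^esub> f = \<zero>\<^bsub>cont_ring X\<^esub>"
      by (rule bexI[of _ "\<lambda>x\<in>topspace X. - f x"])
        (use f in \<open>auto simp: continuous_map_restrict_real intro: continuous_map_minus\<close>)
  qed (auto simp: continuous_map_restrict_real algebra_simps extensional_def fun_eq_iff
      intro: continuous_map_add)
  show "comm_monoid (cont_ring X)"
    by (rule comm_monoidI)
      (auto simp: continuous_map_restrict_real algebra_simps extensional_def fun_eq_iff
        intro: continuous_map_real_mult)
qed (auto simp: algebra_simps fun_eq_iff)

lemma nat_pow_cont_ring: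
  "f [^]\<^bsub>cont_ring X\<^esub> (n::nat) = (\<lambda>x\<in>topspace X. f x ^ n)"
  by (induction n) (auto simp: nat_pow_def fun_eq_iff)

lemma reduced_cont_ring: "reduced_ring (cont_ring X)"
  unfolding reduced_ring_def
proof (intro conjI cring_cont_ring ballI allI impI)
  fix f and n :: nat
  assume f: "f \<in> carrier (cont_ring X)"
    and eq: "f [^]\<^bsub>cont_ring X\<^esub> n = \<zero>\<^bsub>cont_ring X\<^esub>"
  have "f x = 0" if "x \<in> topspace X" for x
    using fun_cong[OF eq, of x] that by (simp add: nat_pow_cont_ring)
  with f show "f = \<zero>\<^bsub>cont_ring X\<^esub>"
    by (auto simp: extensional_def fun_eq_iff)
qed

lemma le_rr_cont_ring:
  "f \<sqsubseteq>\<^bsub>rr_order (cont_ring X)\<^esub> g \<longleftrightarrow> (\<forall>x\<in>topspace X. f x * g x = (f x)\<^sup>2)"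
  by (auto simp: rr_order_def nat_pow_cont_ring fun_eq_iff)

lemma partial_order_rr_cont_ring: "partial_order (rr_order (cont_ring X))"
proof
  fix f g
  assume fg: "f \<sqsubseteq>\<^bsub>rr_order (cont_ring X)\<^esub> g" "g \<sqsubseteq>\<^bsub>rr_order (cont_ring X)\<^esub> f"
    and C: "f \<in> carrier (rr_order (cont_ring X))" "g \<in> carrier (rr_order (cont_ring X))"
  have "f x = g x" if "x \<in> topspace X" for x
    using fg that unfolding le_rr_cont_ring power2_eq_square
    by (metis mult_cancel_left mult_cancel_right)
  with C have "f = g"
    by (auto simp: rr_order_def intro: extensionalityI)
  then show "f .=\<^bsub>rr_order (cont_ring X)\<^esub> g" by (simp add: rr_order_def)
next
  fix f g h
  assume "f \<sqsubseteq>\<^bsub>rr_order (cont_ring X)\<^esub> g" "g \<sqsubseteq>\<^bsub>rr_order (cont_ring X)\<^esub> h"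
  then show "f \<sqsubseteq>\<^bsub>rr_order (cont_ring X)\<^esub> h"
    unfolding le_rr_cont_ring power2_eq_square by (metis mult_cancel_left)
qed (auto simp: rr_order_def nat_pow_cont_ring power2_eq_square)

text \<open>
  The order axioms contained in \<^locale>\<open>lower_semilattice\<close> hold for every \<open>X\<close>, so being rr-good
  is precisely the existence of infima of pairs.
\<close>

lemma rr_good_iff:
  "rr_good X \<longleftrightarrow>
     (\<forall>f\<in>carrier (cont_ring X). \<forall>g\<in>carrier (cont_ring X).
        \<exists>h. is_glb (rr_order (cont_ring X)) h {f, g})"
proof -
  have [simp]: "carrier (rr_order (cont_ring X)) = carrier (cont_ring X)"
    by (simp add: rr_order_def)
  interpret partial_order "rr_order (cont_ring X)"
    by (rule partial_order_rr_cont_ring)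
  show ?thesis
  proof
    assume "rr_good X"
    then interpret lower_semilattice "rr_order (cont_ring X)"
      by (simp add: rr_good_def)
    show "\<forall>f\<in>carrier (cont_ring X). \<forall>g\<in>carrier (cont_ring X).
        \<exists>h. is_glb (rr_order (cont_ring X)) h {f, g}"
      using inf_of_two_exists by auto
  next
    assume *: "\<forall>f\<in>carrier (cont_ring X). \<forall>g\<in>carrier (cont_ring X).
        \<exists>h. is_glb (rr_order (cont_ring X)) h {f, g}"
    show "rr_good X"
      unfolding rr_good_def by unfold_locales (use * in auto)
  qed
qed

end

theory Submission
  imports Defs
begin

text \<open>
  If \<open>h\<close> is an rr-lower bound of \<open>f\<close> and \<open>g\<close>, then the cozero set of \<open>h\<close> is a clopen subset of the
  cozero set of \<open>f\<close> on which \<open>h = f = g\<close>; conversely, every clopen subset of the cozero set of \<open>f\<close>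
  on which \<open>f = g\<close> yields a lower bound, by cutting \<open>f\<close> off to \<open>0\<close> outside it.  So the infimum
  exists exactly when there is a largest such clopen set.  In a locally connected space this is the
  union of those components of the cozero set of \<open>f\<close> on which \<open>f = g\<close>.

  For the counterexample take the fan in the plane consisting of the segments from the origin to
  the points \<open>(1, s)\<close> with \<open>s\<close> in \<open>[-1, 0] \<union> {1/n | n \<ge> 1}\<close>, and let \<open>f (t, y) = t\<close> and
  \<open>g (t, y) = t + (\<bar>y\<bar> - y)\<close>, which agree exactly where \<open>y \<ge> 0\<close>.  An infimum would have to equal
  \<open>f\<close> on the segments of positive slope and vanish on those of negative slope, so it is
  discontinuous at \<open>(1, 0)\<close>.
\<close>

section \<open>The rr-order on \<open>C(X)\<close> and cutting off functions\<close>

lemma carrier_rr_order [simp]: "carrier (rr_order R) = carrier R"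
  by (simp add: rr_order_def)

lemma is_glb_rr_iff:
  assumes "f \<in> carrier (cont_ring X)" "g \<in> carrier (cont_ring X)"
  shows "is_glb (rr_order (cont_ring X)) h {f, g} \<longleftrightarrow>
    h \<in> carrier (cont_ring X) \<and>
    h \<sqsubseteq>\<^bsub>rr_order (cont_ring X)\<^esub> f \<and> h \<sqsubseteq>\<^bsub>rr_order (cont_ring X)\<^esub> g \<and>
    (\<forall>k\<in>carrier (cont_ring X). k \<sqsubseteq>\<^bsub>rr_order (cont_ring X)\<^esub> f \<longrightarrow>
       k \<sqsubseteq>\<^bsub>rr_order (cont_ring X)\<^esub> g \<longrightarrow> k \<sqsubseteq>\<^bsub>rr_order (cont_ring X)\<^esub> h)"
  using assms unfolding greatest_def Lower_def by auto

text \<open>Cancel \<open>f x\<close> where it is nonzero. In this form \<open>f\<close> is visibly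
  \<open>g\<close> cut off to zero outside the cozero set of \<open>f\<close>.\<close>

lemma le_rr_cont_ring_iff:
  "f \<sqsubseteq>\<^bsub>rr_order (cont_ring X)\<^esub> g \<longleftrightarrow> (\<forall>x\<in>topspace X. f x \<noteq> 0 \<longrightarrow> f x = g x)"
  unfolding le_rr_cont_ring by (auto simp: power2_eq_square)

text \<open>Outside \<open>U\<close> lie only \<open>V\<close> and the zeros of \<open>f\<close>. If
  \<open>0 \<in> W\<close>, those zeros are already in the preimage of \<open>W\<close> under
  \<open>f\<close>, so only \<open>V\<close> must be added to it; otherwise that preimage is
  intersected with \<open>U\<close>.\<close>

lemma cutoff_in_cont_ring:
  assumes f: "continuous_map X euclideanreal f"
    and U: "openin X U" and V: "openin X V" and disj: "disjnt U V"
    and UV: "U \<union> V = {x \<in> topspace X. f x \<noteq> 0}"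
  shows "(\<lambda>x\<in>topspace X. if x \<in> U then f x else 0) \<in> carrier (cont_ring X)"
proof -
  have "continuous_map X euclideanreal (\<lambda>x. if x \<in> U then f x else 0)"
    unfolding continuous_map_def
  proof (intro conjI allI impI)
    fix W :: "real set"
    assume "openin euclideanreal W"
    then have fW: "openin X {x \<in> topspace X. f x \<in> W}"
      using f by (simp add: continuous_map_def)
    show "openin X {x \<in> topspace X. (if x \<in> U then f x else 0) \<in> W}"
    proof (cases "0 \<in> W")
      case True
      then have "{x \<in> topspace X. (if x \<in> U then f x else 0) \<in> W} = {x \<in> topspace X. f x \<in> W} \<union> V"
        using UV disj by (auto simp: disjnt_iff)
      with fW V show ?thesis by auto
    next
      case False
      then have "{x \<in> topspace X. (if x \<in> U then f x else 0) \<in> W} = {x \<in> topspace X. f x \<in> W} \<inter> U"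
        using UV by auto
      with fW U show ?thesis by auto
    qed
  qed auto
  then show ?thesis
    by (simp add: continuous_map_restrict_real)
qed

section \<open>Locally connected spaces\<close>

lemma locally_connected_imp_rr_good:
  assumes X: "locally_connected_space X"
  shows "rr_good X"
  unfolding rr_good_iff
proof (intro ballI)
  fix f g
  assume f: "f \<in> carrier (cont_ring X)" and g: "g \<in> carrier (cont_ring X)"
  define D where "D = {x \<in> topspace X. f x \<noteq> 0}"
  define Y where "Y = subtopology X D"
  define \<U> where "\<U> = {C \<in> connected_components_of Y. \<forall>x\<in>C. f x = g x}"
  define h where "h = (\<lambda>x\<in>topspace X. if x \<in> \<Union>\<U> then f x else 0)"
  have fc: "continuous_map X euclideanreal f"
    using f by simp
  have open_nz: "openin X {x \<in> topspace X. k x \<noteq> 0}" if "continuous_map X euclideanreal k" for k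
    using openin_continuous_map_preimage [OF that, of "- {0}"]
    by (simp add: open_Compl)
  have D: "openin X D"
    unfolding D_def by (rule open_nz [OF fc])
  \<comment> \<open>Local connectedness enters here: it passes to the open set \<open>D\<close>,
    whose components are then open in \<open>D\<close> and hence in \<open>X\<close>.\<close>
  have comp_open: "openin X C" if "C \<in> connected_components_of Y" for C
    using that openin_connected_components_of_locally_connected_space
      locally_connected_space_open_subset [OF X D] openin_open_subtopology [OF D]
    unfolding Y_def by blast
  have topY: "topspace Y = D"
    unfolding Y_def D_def by auto
  have Union_D: "\<Union>(connected_components_of Y) = D"
    by (simp add: Union_connected_components_of topY)
  have h: "h \<in> carrier (cont_ring X)"
    unfolding h_def
  proof (rule cutoff_in_cont_ring [where V = "\<Union>(connected_components_of Y - \<U>)"])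
    show "disjnt (\<Union>\<U>) (\<Union>(connected_components_of Y - \<U>))"
      using pairwise_disjoint_connected_components_of [of Y]
      unfolding \<U>_def pairwise_def disjnt_iff by blast
    show "\<Union>\<U> \<union> \<Union>(connected_components_of Y - \<U>) = {x \<in> topspace X. f x \<noteq> 0}"
      using Union_D unfolding D_def \<U>_def by blast
  qed (use fc comp_open in \<open>auto simp: \<U>_def\<close>)
  have "k \<sqsubseteq>\<^bsub>rr_order (cont_ring X)\<^esub> h"
    if k: "k \<in> carrier (cont_ring X)"
      and kf: "k \<sqsubseteq>\<^bsub>rr_order (cont_ring X)\<^esub> f" and kg: "k \<sqsubseteq>\<^bsub>rr_order (cont_ring X)\<^esub> g" for k
    unfolding le_rr_cont_ring_iff
  proof (intro ballI impI)
    fix x assume x: "x \<in> topspace X" "k x \<noteq> 0"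
    define T where "T = {x \<in> topspace X. k x \<noteq> 0}"
    have TD: "T \<subseteq> D"
      using kf unfolding T_def D_def le_rr_cont_ring_iff by auto
    have "continuous_map X euclideanreal k"
      using k by simp
    then have "openin X T" "openin X {x \<in> topspace X. k x - f x \<noteq> 0}"
      unfolding T_def by (intro open_nz continuous_map_diff fc; assumption)+
    \<comment> \<open>On \<open>T\<close> the function \<open>k\<close> equals \<open>f\<close>,
      while on \<open>D - T\<close> it is 0 and \<open>f\<close> is not. Hence \<open>T\<close> is
      clopen in \<open>D\<close>, and a component of \<open>D\<close> meeting \<open>T\<close> lies
      inside it.\<close>
    moreover have "D - T = {x \<in> topspace X. k x - f x \<noteq> 0}"
      using kf unfolding T_def D_def le_rr_cont_ring_iff by auto
    ultimately have T: "openin Y T" "closedin Y T"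
      using TD openin_open_subtopology [OF D] unfolding closedin_def topY unfolding Y_def
      by simp_all (metis Diff_subset)
    have "x \<in> D"
      using x TD by (auto simp: T_def)
    then obtain C where C: "C \<in> connected_components_of Y" "x \<in> C"
      using Union_D by blast
    have "C \<subseteq> T"
      using connectedin_clopen_cases [OF connectedin_connected_components_of [OF C(1)] T(2,1)] x C(2)
      by (auto simp: T_def disjnt_iff)
    then have "\<forall>y\<in>C. f y = g y"
      using kf kg unfolding T_def le_rr_cont_ring_iff by fastforce
    then have "x \<in> \<Union>\<U>"
      using C unfolding \<U>_def by blast
    then show "k x = h x"
      using x kf unfolding h_def le_rr_cont_ring_iff by simp
  qed
  moreover have "h \<sqsubseteq>\<^bsub>rr_order (cont_ring X)\<^esub> f" "h \<sqsubseteq>\<^bsub>rr_order (cont_ring X)\<^esub> g"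
    unfolding le_rr_cont_ring_iff h_def \<U>_def by auto
  ultimately show "\<exists>h. is_glb (rr_order (cont_ring X)) h {f, g}"
    using h unfolding is_glb_rr_iff [OF f g] by blast
qed

section \<open>The fan: a compact connected subset of the plane\<close>

definition slopes :: "real set" where
  "slopes = {-1..0} \<union> insert 0 (range (\<lambda>n. 1 / real (Suc n)))"

definition fan :: "(real \<times> real) set" where
  "fan = (\<lambda>(t, s). (t, t * s)) ` ({0..1} \<times> slopes)"

lemma fanE:
  assumes "p \<in> fan"
  obtains t s where "p = (t, t * s)" "0 \<le> t" "t \<le> 1" "s \<in> slopes"
proof -
  obtain q where "q \<in> {0..1} \<times> slopes" "p = (\<lambda>(t, s). (t, t * s)) q"
    using assms unfolding fan_def by blast
  then show thesis
    by (intro that [of "fst q" "snd q"]) (auto simp: case_prod_unfold)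
qed

lemma compact_fan: "compact fan"
proof -
  have "(\<lambda>n. 1 / real (Suc n)) \<longlonglongrightarrow> 0"
    using LIMSEQ_inverse_real_of_nat by (simp add: inverse_eq_divide)
  then have "compact slopes"
    unfolding slopes_def by (intro compact_Un compact_sequence_with_limit compact_Icc)
  then show ?thesis
    unfolding fan_def
    by (intro compact_continuous_image compact_Times compact_Icc)
      (auto simp: case_prod_unfold intro!: continuous_intros)
qed

lemma starlike_fan: "starlike fan"
  unfolding starlike_def
proof (intro bexI ballI)
  have "0 \<in> slopes"
    by (simp add: slopes_def)
  then show "(0, 0) \<in> fan"
    unfolding fan_def by (force intro: image_eqI [of _ _ "(0, 0)"])
  fix p assume "p \<in> fan"
  then obtain t s where p: "p = (t, t * s)" "0 \<le> t" "t \<le> 1" "s \<in> slopes"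
    by (rule fanE)
  show "closed_segment (0, 0) p \<subseteq> fan"
  proof
    fix q assume "q \<in> closed_segment (0, 0) p"
    then obtain u where u: "0 \<le> u" "u \<le> 1" and q: "q = (u * t, u * t * s)"
      unfolding closed_segment_def p(1) by auto
    have "u * t \<in> {0..1}"
      using u p by (simp add: mult_le_one)
    with q p(4) show "q \<in> fan"
      unfolding fan_def by (intro image_eqI [of _ _ "(u * t, s)"]) auto
  qed
qed

text \<open>The line has slope \<open>1/(n + 3/2)\<close>, strictly between the consecutive slopes
  \<open>1/(n+1)\<close> and \<open>1/(n+2)\<close>, so it splits the fan minus the origin into two
  relatively open pieces.\<close>

lemma fan_not_on_separating_line:
  assumes "p \<in> fan" "fst p \<noteq> 0"
  shows "(real n + 3/2) * snd p \<noteq> fst p"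
proof
  assume eq: "(real n + 3/2) * snd p = fst p"
  obtain t s where p: "p = (t, t * s)" "s \<in> slopes"
    using assms(1) by (rule fanE)
  have "t * ((real n + 3/2) * s) = t * 1"
    using eq p(1) by (simp add: algebra_simps)
  then have s: "(real n + 3/2) * s = 1"
    using assms(2) p(1) by (subst (asm) mult_cancel_left) simp
  then have "s > 0"
    by (smt (verit) divide_nonneg_nonneg mult_nonneg_nonpos of_nat_0_le_iff)
  with p(2) obtain m where "s = 1 / real (Suc m)"
    unfolding slopes_def by auto
  \<comment> \<open>Clearing denominators equates an odd and an even number.\<close>
  with s have "real (2 * n + 3) = real (2 * Suc m)"
    by (simp add: field_simps)
  then show False
    unfolding of_nat_eq_iff by presburger
qed

lemma in_fanI: "s \<in> slopes \<Longrightarrow> (1, s) \<in> fan"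
  unfolding fan_def by (force intro: image_eqI [of _ _ "(1, s)"])

section \<open>Two functions on the fan without infimum\<close>

lemma not_rr_good_fan: "\<not> rr_good (top_of_set fan)"
proof
  let ?R = "cont_ring (top_of_set fan)"
  define f where "f = (\<lambda>p\<in>fan. fst p)"
  define g where "g = (\<lambda>p\<in>fan. fst p + (\<bar>snd p\<bar> - snd p))"
  assume "rr_good (top_of_set fan)"
  moreover have f: "f \<in> carrier ?R" and g: "g \<in> carrier ?R"
    unfolding f_def g_def
    by (auto simp: continuous_map_restrict_real [of "top_of_set fan", simplified]
        intro!: continuous_intros)
  ultimately obtain h where h: "h \<in> carrier ?R"
    "h \<sqsubseteq>\<^bsub>rr_order ?R\<^esub> f" "h \<sqsubseteq>\<^bsub>rr_order ?R\<^esub> g"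
    and greatest: "\<And>k. k \<in> carrier ?R \<Longrightarrow> k \<sqsubseteq>\<^bsub>rr_order ?R\<^esub> f \<Longrightarrow>
      k \<sqsubseteq>\<^bsub>rr_order ?R\<^esub> g \<Longrightarrow> k \<sqsubseteq>\<^bsub>rr_order ?R\<^esub> h"
    unfolding rr_good_iff using is_glb_rr_iff [OF f g] by meson
  have hc: "continuous_on fan h"
    using h(1) by simp

  \<comment> \<open>Cutting \<open>f\<close> off to the part \<open>U\<close> of the fan above the
    separating line gives a lower bound \<open>k\<close>. As \<open>k\<close> is 1 at this endpoint,
    \<open>k\<close> lying below \<open>h\<close> forces \<open>h\<close> to be 1 there.\<close>
  have on_pos: "h (1, 1 / real (Suc n)) = 1" for n
  proof -
    define U where "U = {p \<in> fan. fst p < (real n + 3/2) * snd p}"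
    define V where "V = {p \<in> fan. fst p > (real n + 3/2) * snd p}"
    define k where "k = (\<lambda>p\<in>topspace (top_of_set fan). if p \<in> U then f p else 0)"
    have fst_nonneg: "fst p \<ge> 0" if "p \<in> fan" for p
      using that by (rule fanE) simp
    have snd_pos: "snd p > 0" if "p \<in> U" for p
    proof -
      have "0 < (real n + 3/2) * snd p"
        using that fst_nonneg [of p] unfolding U_def by auto
      then show ?thesis
        by (simp add: zero_less_mult_iff)
    qed
    have snd_eq_0: "snd p = 0" if "p \<in> fan" "fst p = 0" for p
      using that(1) by (rule fanE) (use that(2) in simp)
    have "k \<in> carrier ?R"
      unfolding k_def
    proof (rule cutoff_in_cont_ring)
      have "open {p :: real \<times> real. fst p < (real n + 3/2) * snd p}"
        "open {p :: real \<times> real. (real n + 3/2) * snd p < fst p}"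
        by (auto intro!: open_Collect_less continuous_intros)
      then show "openin (top_of_set fan) U" "openin (top_of_set fan) V"
        unfolding U_def V_def openin_open by auto
      show "U \<union> V = {p \<in> topspace (top_of_set fan). f p \<noteq> 0}"
      proof (intro equalityI subsetI)
        fix p assume "p \<in> U \<union> V"
        then show "p \<in> {p \<in> topspace (top_of_set fan). f p \<noteq> 0}"
          using snd_eq_0 [of p] by (auto simp: U_def V_def f_def)
      next
        fix p assume "p \<in> {p \<in> topspace (top_of_set fan). f p \<noteq> 0}"
        then have "p \<in> fan" "fst p \<noteq> 0"
          by (auto simp: f_def)
        then show "p \<in> U \<union> V"
          using fan_not_on_separating_line [of p n] by (auto simp: U_def V_def)
      qed
    qed (use f in \<open>auto simp: U_def V_def disjnt_iff\<close>)
    moreover have "k \<sqsubseteq>\<^bsub>rr_order ?R\<^esub> f" "k \<sqsubseteq>\<^bsub>rr_order ?R\<^esub> g"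
      using snd_pos unfolding le_rr_cont_ring_iff k_def f_def g_def by (auto simp: abs_of_pos)
    ultimately have "k \<sqsubseteq>\<^bsub>rr_order ?R\<^esub> h"
      by (rule greatest)
    moreover have "(1, 1 / real (Suc n)) \<in> fan"
      by (rule in_fanI) (simp add: slopes_def)
    moreover from this have "(1, 1 / real (Suc n)) \<in> U"
      using less_divide_eq_1_pos [of "real (Suc n)" "real n + 3/2"] by (simp add: U_def)
    ultimately show ?thesis
      unfolding le_rr_cont_ring_iff k_def f_def by auto
  qed
  \<comment> \<open>A nonzero value would have to equal both \<open>f = 1\<close> and
    \<open>g = 1 + 2/(n+1)\<close>.\<close>
  have on_neg: "h (1, - (1 / real (Suc n))) = 0" for n
  proof -
    have "(1, - (1 / real (Suc n))) \<in> fan"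
      by (rule in_fanI) (simp add: slopes_def)
    then show ?thesis
      using h(2,3) unfolding le_rr_cont_ring_iff f_def g_def by (auto simp: field_simps)
  qed

  have lim: "(\<lambda>n. 1 / real (Suc n)) \<longlonglongrightarrow> 0"
    using LIMSEQ_inverse_real_of_nat by (simp add: inverse_eq_divide)
  \<comment> \<open>Applied to positive and to negative slopes tending to 0, continuity gives
    \<open>h (1, 0)\<close> the two values 1 and 0.\<close>
  have h_limit: "h (1, 0) = c"
    if s: "s \<longlonglongrightarrow> 0" "\<And>n. s n \<in> slopes" and c: "\<And>n. h (1, s n) = c" for s c
  proof -
    have "(\<lambda>n. h (1, s n)) \<longlonglongrightarrow> h (1, 0)"
    proof (rule continuous_on_tendsto_compose [OF hc])
      show "(\<lambda>n. (1, s n)) \<longlonglongrightarrow> (1, 0)"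
        using s(1) by (intro tendsto_intros)
      show "(1, 0) \<in> fan"
        by (rule in_fanI) (simp add: slopes_def)
      show "\<forall>\<^sub>F n in sequentially. (1, s n) \<in> fan"
        using s(2) by (simp add: in_fanI)
    qed
    then show ?thesis
      by (simp add: c LIMSEQ_const_iff)
  qed
  have "h (1, 0) = 1"
    using lim _ on_pos by (rule h_limit) (simp add: slopes_def)
  moreover have "h (1, 0) = 0"
  proof (rule h_limit)
    show "(\<lambda>n. - (1 / real (Suc n))) \<longlonglongrightarrow> 0"
      using tendsto_minus [OF lim] by simp
  qed (use on_neg in \<open>auto simp: slopes_def\<close>)
  ultimately show False
    by simp
qed

theorem theorem3p5:
  shows "(\<forall>X :: 'a topology.
            completely_regular_space X \<and> Hausdorff_space X \<and> locally_connected_space X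
              \<longrightarrow> rr_good X) \<and>
         (\<exists>m :: (real \<times> real) metric.
            compact_space (mtopology_of m) \<and> connected_space (mtopology_of m) \<and>
            \<not> rr_good (mtopology_of m))"
proof (intro conjI allI impI exI)
  fix X :: "'a topology"
  assume "completely_regular_space X \<and> Hausdorff_space X \<and> locally_connected_space X"
  then show "rr_good X"
    by (simp add: locally_connected_imp_rr_good)
next
  let ?m = "submetric euclidean_metric fan"
  have top: "mtopology_of ?m = top_of_set fan"
    by (simp add: mtopology_of_submetric)
  show "compact_space (mtopology_of ?m)"
    using compact_fan by (simp add: top compact_space_subtopology)
  show "connected_space (mtopology_of ?m)"
    using starlike_imp_connected [OF starlike_fan]
    by (simp add: top connected_space_subtopology)
  show "\<not> rr_good (mtopology_of ?m)"
    by (simp add: top not_rr_good_fan)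
qed

end
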